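(* Let $\mathcal K$ contain all Lorentz cones, and let $F(x)=Ax+a$ be an affine monotone vector field on $\mathcal X=E=\mathbb R^n$. Then the constraint $$t\geq x^T\bar Ax+a^Tx,\qquad g=Ax+a$$ in variables $t,g,x$, where $\bar A=\frac12[A+A^T]$, can be written as a $\mathcal K$-conic constraint, and it is a $\mathcal K$-representation of $(F,\mathbb R^n)$.
   Context: $\mathcal K$ is a fixed family of regular cones (closed, convex, pointed, with nonempty interior) in Euclidean spaces which contains $\mathbb R_+$, is closed under finite direct products, and is closed under passing to dual cones. $a\leq_{\mathbf K}b$ means $b-a\in\mathbf K$. A $\mathcal K$-conic constraint is a constraint $Ax\leq_{\mathbf K}a$ with $\mathbf K\in\mathcal K$; finite systems of such constraints, linear equalities and nonstrict linear inequalities are equivalent to a single such constraint. The Lorentz cones are $\{x\in\mathbb R^k:x_k\geq\sqrt{x_1^2+\dots+x_{k-1}^2}\}$. Let $\mathcal X$ be a nonempty convex subset of a Euclidean space $E$. A vector field $F:\mathcal X\to E$ is monotone if $\langle F(x)-F(y),x-y\rangle\geq0$ for all $x,y\in\mathcal X$. For continuous monotone $F$ put $$\mathcal F[F,\mathcal X]=\{[t;g;x]\in\mathbb R\times E\times E: x\in\mathcal X,\ t-\langle g,y\rangle\geq\langle F(y),x-y\rangle\ \forall y\in\mathcal X\}.$$ A conic constraint $Xx+Gg+tT+Uu\leq_{\mathbf K}a$, $\mathbf K\in\mathcal K$ (or an equivalent finite system), in variables $t,g,x$ and additional variables $u$, with projection $\mathcal T$ of its solution set on the space of $[t;g;x]$,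 is a $\mathcal K$-representation of $(F,\mathcal X)$ if (i) $\mathcal T\subset\mathcal F[F,\mathcal X]$ and $[t;g;x]\in\mathcal T$, $t'\geq t$ imply $[t';g;x]\in\mathcal T$; and (ii) $\mathcal T\supset\{[\langle F(x),x\rangle;F(x);x]:x\in\mathcal X\}$. *)

theory Defs
  imports "HOL-Analysis.Analysis"
begin

text \<open>
  The cones of a family live in spaces of different dimensions, so the ambient Euclidean space
  \<open>\<real>\<^sup>m\<close> of a cone is \<^const>\<open>Euclidean_space\<close> \<open>m\<close>: functions \<^typ>\<open>nat \<Rightarrow> real\<close> vanishing from index \<open>m\<close> on,
  with coordinates \<open>0, \<dots>, m - 1\<close> and the usual topology.
\<close>

abbreviation Rvec :: "nat \<Rightarrow> (nat \<Rightarrow> real) set" where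
  "Rvec m \<equiv> topspace (Euclidean_space m)"

definition regular_cone :: "nat \<Rightarrow> (nat \<Rightarrow> real) set \<Rightarrow> bool" where
  "regular_cone m K \<longleftrightarrow>
     (\<forall>x\<in>K. \<forall>c\<ge>0. (\<lambda>i. c * x i) \<in> K) \<and>
     closedin (Euclidean_space m) K \<and>
     (\<forall>x\<in>K. \<forall>y\<in>K. \<forall>u\<ge>0. \<forall>v\<ge>0. u + v = 1 \<longrightarrow> (\<lambda>i. u * x i + v * y i) \<in> K) \<and>
     (\<forall>x. x \<in> K \<and> (\<lambda>i. - x i) \<in> K \<longrightarrow> x = (\<lambda>i. 0)) \<and>
     (Euclidean_space m) interior_of K \<noteq> {}"

definition dual_cone :: "nat \<Rightarrow> (nat \<Rightarrow> real) set \<Rightarrow> (nat \<Rightarrow> real) set" where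
  "dual_cone m K = {y \<in> Rvec m. \<forall>x\<in>K. (\<Sum>i<m. y i * x i) \<ge> 0}"

definition prod_cone ::
  "nat \<Rightarrow> (nat \<Rightarrow> real) set \<Rightarrow> nat \<Rightarrow> (nat \<Rightarrow> real) set \<Rightarrow> (nat \<Rightarrow> real) set" where
  "prod_cone m K l L =
     {z \<in> Rvec (m + l). (\<lambda>i. if i < m then z i else 0) \<in> K \<and> (\<lambda>i. z (m + i)) \<in> L}"

definition nonneg_ray :: "(nat \<Rightarrow> real) set" where
  "nonneg_ray = {x \<in> Rvec 1. x 0 \<ge> 0}"

text \<open>Meaningful for \<open>k \<ge> 1\<close>; the distinguished coordinate is the last one, of index \<open>k - 1\<close>.\<close>

definition Lorentz_cone :: "nat \<Rightarrow> (nat \<Rightarrow> real) set" where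
  "Lorentz_cone k = {x \<in> Rvec k. x (k - 1) \<ge> sqrt (\<Sum>i<k - 1. (x i)\<^sup>2)}"

text \<open>\<open>\<K> m\<close> is the set of members of the family that are cones in \<open>\<real>\<^sup>m\<close>.\<close>

definition cone_family :: "(nat \<Rightarrow> (nat \<Rightarrow> real) set set) \<Rightarrow> bool" where
  "cone_family \<K> \<longleftrightarrow>
     (\<forall>m. \<forall>K \<in> \<K> m. regular_cone m K) \<and>
     nonneg_ray \<in> \<K> 1 \<and>
     (\<forall>m l. \<forall>K \<in> \<K> m. \<forall>L \<in> \<K> l. prod_cone m K l L \<in> \<K> (m + l)) \<and>
     (\<forall>m. \<forall>K \<in> \<K> m. dual_cone m K \<in> \<K> m)"

definition cone_le :: "(nat \<Rightarrow> real) set \<Rightarrow> (nat \<Rightarrow> real) \<Rightarrow> (nat \<Rightarrow> real) \<Rightarrow> bool" where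
  "cone_le K p q \<longleftrightarrow> (\<lambda>i. q i - p i) \<in> K"

text \<open>
  Data of a constraint \<open>Xx + Gg + tT + Uu \<le>\<^bsub>K\<^esub> b\<close> with \<open>K \<subseteq> \<real>\<^sup>m\<close>, \<open>x, g \<in> E\<close>, \<open>u \<in> \<real>\<^sup>k\<close>.
  The linear maps \<open>X, G : E \<rightarrow> \<real>\<^sup>m\<close> are given by their rows, the \<open>i\<close>-th coordinate of \<open>Xx\<close> being
  the inner product of row \<open>i\<close> with \<open>x\<close>; \<open>U\<close> is an \<open>m \<times> k\<close> matrix.
  Only entries with row index below \<open>m\<close> and column index below \<open>k\<close> matter.
\<close>

record 'e conic_constraint =
  row_dim :: nat
  cone_of :: "(nat \<Rightarrow> real) set"
  aux_dim :: nat
  X_rows :: "nat \<Rightarrow> 'e"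
  G_rows :: "nat \<Rightarrow> 'e"
  T_vec :: "nat \<Rightarrow> real"
  U_mat :: "nat \<Rightarrow> nat \<Rightarrow> real"
  rhs_vec :: "nat \<Rightarrow> real"

definition is_conic_constraint ::
  "(nat \<Rightarrow> (nat \<Rightarrow> real) set set) \<Rightarrow> ('e::euclidean_space) conic_constraint \<Rightarrow> bool" where
  "is_conic_constraint \<K> C \<longleftrightarrow> cone_of C \<in> \<K> (row_dim C)"

definition conic_lhs ::
  "('e::euclidean_space) conic_constraint \<Rightarrow> real \<Rightarrow> 'e \<Rightarrow> 'e \<Rightarrow> (nat \<Rightarrow> real) \<Rightarrow> nat \<Rightarrow> real" where
  "conic_lhs C t g x u =
     (\<lambda>i. if i < row_dim C
          then X_rows C i \<bullet> x + G_rows C i \<bullet> g + t * T_vec C i + (\<Sum>j<aux_dim C. U_mat C i j * u j)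
          else 0)"

definition conic_rhs :: "('e::euclidean_space) conic_constraint \<Rightarrow> nat \<Rightarrow> real" where
  "conic_rhs C = (\<lambda>i. if i < row_dim C then rhs_vec C i else 0)"

definition conic_solutions ::
  "('e::euclidean_space) conic_constraint \<Rightarrow> (real \<times> 'e \<times> 'e \<times> (nat \<Rightarrow> real)) set" where
  "conic_solutions C =
     {(t, g, x, u). u \<in> Rvec (aux_dim C) \<and> cone_le (cone_of C) (conic_lhs C t g x u) (conic_rhs C)}"

definition conic_projection :: "('e::euclidean_space) conic_constraint \<Rightarrow> (real \<times> 'e \<times> 'e) set" where
  "conic_projection C = {(t, g, x). \<exists>u. (t, g, x, u) \<in> conic_solutions C}"

definition monotone_field :: "('e::euclidean_space) set \<Rightarrow> ('e \<Rightarrow> 'e) \<Rightarrow> bool" where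
  "monotone_field S F \<longleftrightarrow> (\<forall>x\<in>S. \<forall>y\<in>S. (F x - F y) \<bullet> (x - y) \<ge> 0)"

definition field_set :: "(('e::euclidean_space) \<Rightarrow> 'e) \<Rightarrow> 'e set \<Rightarrow> (real \<times> 'e \<times> 'e) set" where
  "field_set F S = {(t, g, x). x \<in> S \<and> (\<forall>y\<in>S. t - g \<bullet> y \<ge> F y \<bullet> (x - y))}"

definition conic_representation ::
  "(nat \<Rightarrow> (nat \<Rightarrow> real) set set) \<Rightarrow> ('e::euclidean_space) conic_constraint \<Rightarrow>
     ('e \<Rightarrow> 'e) \<Rightarrow> 'e set \<Rightarrow> bool" where
  "conic_representation \<K> C F S \<longleftrightarrow>
     is_conic_constraint \<K> C \<and>
     conic_projection C \<subseteq> field_set F S \<and>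
     (\<forall>t t' g x. (t, g, x) \<in> conic_projection C \<and> t' \<ge> t \<longrightarrow> (t', g, x) \<in> conic_projection C) \<and>
     {(F x \<bullet> x, F x, x) | x. x \<in> S} \<subseteq> conic_projection C"

end

theory Submission
  imports Defs
begin

text \<open>
  The symmetric part of the linear part of a monotone affine field is positive semidefinite, so its
  quadratic form is a sum of squares \<open>\<Sum>i (b\<^sub>i \<bullet> x)\<^sup>2\<close> (a Cholesky elimination over an orthonormal
  basis). With \<open>s = t - a \<bullet> x\<close> the inequality \<open>\<Sum>i (b\<^sub>i \<bullet> x)\<^sup>2 \<le> s\<close> says that
  \<open>(2 b\<^sub>1 \<bullet> x, \<dots>, 2 b\<^sub>n \<bullet> x, s - 1, s + 1)\<close> lies in a Lorentz cone, and the equation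
  \<open>g = F x\<close> says that \<open>(F x - g, 0)\<close> does. On the solution set, monotonicity turns
  \<open>t - g \<bullet> y \<ge> F x \<bullet> (x - y)\<close> into \<open>t - g \<bullet> y \<ge> F y \<bullet> (x - y)\<close>.
\<close>

text \<open>Discriminant argument: the form at \<open>x + r *\<^sub>R y\<close> is a polynomial in
  \<open>r\<close> of degree at most two that is never negative.\<close>

lemma psd_Cauchy_Schwarz:
  fixes f :: "'e::real_inner \<Rightarrow> 'e"
  assumes lin: "linear f" and sym: "\<And>x y. x \<bullet> f y = f x \<bullet> y" and psd: "\<And>x. 0 \<le> x \<bullet> f x"
  shows "(x \<bullet> f y)\<^sup>2 \<le> (x \<bullet> f x) * (y \<bullet> f y)"
proof -
  have q: "0 \<le> x \<bullet> f x + 2 * r * (x \<bullet> f y) + r\<^sup>2 * (y \<bullet> f y)" for r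
  proof -
    have "y \<bullet> f x = x \<bullet> f y"
      by (metis inner_commute sym)
    then have "(x + r *\<^sub>R y) \<bullet> f (x + r *\<^sub>R y) = x \<bullet> f x + 2 * r * (x \<bullet> f y) + r\<^sup>2 * (y \<bullet> f y)"
      by (simp add: linear_add[OF lin] linear_scale[OF lin] inner_add distrib_left power2_eq_square)
    then show ?thesis
      by (metis psd)
  qed
  show ?thesis
  proof (cases "y \<bullet> f y = 0")
    case True
    have "x \<bullet> f y = 0"
    proof (rule ccontr)
      assume "x \<bullet> f y \<noteq> 0"
      then show False
        \<comment> \<open>With \<open>y \<bullet> f y = 0\<close> the polynomial is affine in
          \<open>r\<close>; this \<open>r\<close> gives it the value -1.\<close>
        using q[of "- (x \<bullet> f x + 1) / (2 * (x \<bullet> f y))"] True by (simp add: field_simps)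
    qed
    then show ?thesis
      by (simp add: True)
  next
    case False
    then have pos: "0 < y \<bullet> f y"
      using psd[of y] by simp
    \<comment> \<open>The polynomial evaluated at its minimizer.\<close>
    have "0 \<le> x \<bullet> f x - (x \<bullet> f y)\<^sup>2 / (y \<bullet> f y)"
      using q[of "- (x \<bullet> f y) / (y \<bullet> f y)"] pos by (simp add: power2_eq_square)
    then show ?thesis
      using pos by (simp add: field_simps)
  qed
qed

text \<open>Each step splits off one square, a rank-one part of the form, so that one more vector
  enters the kernel of the remainder \<open>g\<close>, which stays symmetric and positive
  semidefinite.\<close>

lemma psd_eliminate:
  fixes f :: "'e::real_inner \<Rightarrow> 'e"
  assumes "finite S" and "linear f" and "\<And>x y. x \<bullet> f y = f x \<bullet> y" and "\<And>x. 0 \<le> x \<bullet> f x"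
  shows "\<exists>b g. linear g \<and> (\<forall>x y. x \<bullet> g y = g x \<bullet> y) \<and> (\<forall>x. 0 \<le> x \<bullet> g x) \<and>
    (\<forall>e\<in>S. g e = 0) \<and> (\<forall>x. x \<bullet> f x = x \<bullet> g x + (\<Sum>e\<in>S. (b e \<bullet> x)\<^sup>2))"
  using assms(1)
proof (induction S rule: finite_induct)
  case empty
  then show ?case
    using assms(2-) by auto
next
  case (insert e S)
  then obtain b g where lin: "linear g" and sym: "\<And>x y. x \<bullet> g y = g x \<bullet> y"
    and psd: "\<And>x. 0 \<le> x \<bullet> g x" and ker: "\<And>d. d \<in> S \<Longrightarrow> g d = 0"
    and eq: "\<And>x. x \<bullet> f x = x \<bullet> g x + (\<Sum>d\<in>S. (b d \<bullet> x)\<^sup>2)"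
    by blast
  have CS: "(x \<bullet> g y)\<^sup>2 \<le> (x \<bullet> g x) * (y \<bullet> g y)" for x y
    by (rule psd_Cauchy_Schwarz[OF lin sym psd])
  \<comment> \<open>If \<open>e \<bullet> g e = 0\<close>, then \<open>c = 0\<close> by division by zero, and \<open>g e = 0\<close> already.\<close>
  define c where "c = (1 / sqrt (e \<bullet> g e)) *\<^sub>R g e"
  define h where "h x = g x - (c \<bullet> x) *\<^sub>R c" for x
  have cc: "(c \<bullet> x) *\<^sub>R c = ((g e \<bullet> x) / (e \<bullet> g e)) *\<^sub>R g e" for x
    using psd[of e] by (simp add: c_def)
  have cx: "(c \<bullet> x)\<^sup>2 = (g e \<bullet> x)\<^sup>2 / (e \<bullet> g e)" for x
    using psd[of e] by (simp add: c_def power_divide)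
  have "linear h"
    unfolding h_def
    by (intro linear_compose_sub lin linearI) (simp_all add: inner_add scaleR_add_left)
  moreover have "x \<bullet> h y = h x \<bullet> y" for x y
    using sym[of x y] by (simp add: h_def inner_diff inner_commute[of x c] inner_commute[of c y])
  moreover have "0 \<le> x \<bullet> h x" for x
  proof -
    \<comment> \<open>Removing the square keeps the form nonnegative: by \<open>cx\<close> this is
      Cauchy-Schwarz for \<open>g\<close> at \<open>e\<close> and \<open>x\<close>.\<close>
    have "(c \<bullet> x)\<^sup>2 \<le> x \<bullet> g x"
    proof (cases "e \<bullet> g e = 0")
      case True
      then show ?thesis
        using psd by (simp add: cx)
    next
      case False
      then show ?thesis
        using CS[of e x] psd[of e] by (simp add: cx sym divide_le_eq mult.commute)
    qed
    then show ?thesis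
      by (simp add: h_def inner_diff power2_eq_square inner_commute)
  qed
  \<comment> \<open>Old kernel vectors stay: for \<open>d\<close> in \<open>S\<close>,
    \<open>g e \<bullet> d = e \<bullet> g d = 0\<close>, so the correction vanishes too. At
    \<open>e\<close> the coefficient in \<open>cc\<close> is 1 and the correction cancels
    \<open>g e\<close>.\<close>
  moreover have "h d = 0" if "d \<in> insert e S" for d
  proof (cases "d \<in> S")
    case True
    then show ?thesis
      using ker sym[of e d] by (simp add: h_def cc)
  next
    case False
    with that have "d = e"
      by simp
    show ?thesis
    proof (cases "e \<bullet> g e = 0")
      case True
      then have "g e = 0"
        \<comment> \<open>The right side is a multiple of \<open>e \<bullet> g e = 0\<close>, the
          left side is the fourth power of the norm of \<open>g e\<close>.\<close>
        using CS[of "g e" e] by simp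
      then show ?thesis
        by (simp add: \<open>d = e\<close> h_def cc)
    next
      case False
      then show ?thesis
        by (simp add: \<open>d = e\<close> h_def cc inner_commute)
    qed
  qed
  moreover have "x \<bullet> f x = x \<bullet> h x + (\<Sum>d\<in>insert e S. ((b(e := c)) d \<bullet> x)\<^sup>2)" for x
  proof -
    have "(\<Sum>d\<in>S. ((b(e := c)) d \<bullet> x)\<^sup>2) = (\<Sum>d\<in>S. (b d \<bullet> x)\<^sup>2)"
      using insert.hyps by (intro sum.cong) auto
    then show ?thesis
      using insert.hyps by (simp add: eq h_def inner_diff power2_eq_square inner_commute)
  qed
  ultimately show ?case
    by blast
qed

text \<open>Once the whole basis is eliminated, the remainder is linear and zero on
  \<open>Basis\<close>, hence zero.\<close>

lemma psd_form_sum_of_squares: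
  fixes f :: "'e::euclidean_space \<Rightarrow> 'e"
  assumes "linear f" and "\<And>x y. x \<bullet> f y = f x \<bullet> y" and "\<And>x. 0 \<le> x \<bullet> f x"
  obtains b :: "'e \<Rightarrow> 'e" where "\<And>x. x \<bullet> f x = (\<Sum>e\<in>Basis. (b e \<bullet> x)\<^sup>2)"
proof -
  obtain b :: "'e \<Rightarrow> 'e" and g where g: "linear g" "\<forall>e\<in>Basis. g e = 0"
    and eq: "\<And>x. x \<bullet> f x = x \<bullet> g x + (\<Sum>e\<in>Basis. (b e \<bullet> x)\<^sup>2)"
    using psd_eliminate[OF finite_Basis assms] by blast
  have "g = (\<lambda>x. 0)"
    using g by (intro linear_eq_stdbasis) (auto simp: linear_zero)
  then show ?thesis
    using that eq by simp
qed

text \<open>Rests on \<open>(s + 1)\<^sup>2 - (s - 1)\<^sup>2 = 4 * s\<close>; the factor 2 in front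
  of \<open>w\<close> matches the 4.\<close>

lemma Lorentz_cone_quadratic_iff:
  assumes "z \<in> Rvec (n + 2)" and "\<And>i. i < n \<Longrightarrow> z i = 2 * w i" and "z n = s - 1" and "z (n + 1) = s + 1"
  shows "z \<in> Lorentz_cone (n + 2) \<longleftrightarrow> (\<Sum>i<n. (w i)\<^sup>2) \<le> s"
proof -
  define W where "W = (\<Sum>i<n. (w i)\<^sup>2)"
  have "0 \<le> W"
    by (simp add: W_def sum_nonneg)
  have "(\<Sum>i<n. (z i)\<^sup>2) = 4 * W"
    using assms(2) by (simp add: W_def sum_distrib_left power_mult_distrib)
  then have "z \<in> Lorentz_cone (n + 2) \<longleftrightarrow> sqrt (4 * W + (s - 1)\<^sup>2) \<le> s + 1"
    using assms by (simp add: Lorentz_cone_def)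
  \<comment> \<open>Squaring needs the sign of \<open>s + 1\<close>; it is recovered below from
    \<open>0 \<le> W\<close> and \<open>W \<le> s\<close>.\<close>
  also have "\<dots> \<longleftrightarrow> 0 \<le> s + 1 \<and> 4 * W + (s - 1)\<^sup>2 \<le> (s + 1)\<^sup>2"
  proof -
    have "0 \<le> sqrt (4 * W + (s - 1)\<^sup>2)"
      using \<open>0 \<le> W\<close> by simp
    then show ?thesis
      by (meson order_trans real_le_lsqrt sqrt_le_D)
  qed
  also have "\<dots> \<longleftrightarrow> W \<le> s"
    using \<open>0 \<le> W\<close> by (auto simp: power2_eq_square algebra_simps)
  finally show ?thesis
    by (simp add: W_def)
qed

text \<open>Lets a system of linear equations enter as one cone membership: a vector of norm at most
  0 is zero.\<close>

lemma Lorentz_cone_zero_iff: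
  assumes "z \<in> Rvec (n + 1)" and "z n = 0"
  shows "z \<in> Lorentz_cone (n + 1) \<longleftrightarrow> (\<forall>i<n. z i = 0)"
proof -
  have "z \<in> Lorentz_cone (n + 1) \<longleftrightarrow> (\<Sum>i<n. (z i)\<^sup>2) \<le> 0"
    using assms by (simp add: Lorentz_cone_def)
  also have "\<dots> \<longleftrightarrow> (\<Sum>i<n. (z i)\<^sup>2) = 0"
    using sum_nonneg[of "{..<n}" "\<lambda>i. (z i)\<^sup>2"] by auto
  also have "\<dots> \<longleftrightarrow> (\<forall>i<n. z i = 0)"
    by (subst sum_nonneg_eq_0_iff) auto
  finally show ?thesis .
qed

lemma conic_constraint_sum_of_squares:
  fixes f b :: "'e::euclidean_space \<Rightarrow> 'e" and a :: 'e
  assumes "cone_family \<K>" and "\<And>k. k \<ge> 1 \<Longrightarrow> Lorentz_cone k \<in> \<K> k" and "linear f"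
  obtains C :: "'e conic_constraint" where "is_conic_constraint \<K> C" and "aux_dim C = 0"
    and "\<And>t g x u. (t, g, x, u) \<in> conic_solutions C \<longleftrightarrow>
      u = (\<lambda>_. 0) \<and> t \<ge> (\<Sum>e\<in>Basis. (b e \<bullet> x)\<^sup>2) + a \<bullet> x \<and> g = f x + a"
proof -
  define n where "n = DIM('e)"
  obtain e :: "nat \<Rightarrow> 'e" where bij: "bij_betw e {..<n} Basis"
    unfolding n_def by (metis ex_bij_betw_nat_finite finite_Basis lessThan_atLeast0)
  \<comment> \<open>The vector placed in the cone is right side minus left side, hence the minus
    signs. Rows below \<open>n\<close> give \<open>2 * (b (e i) \<bullet> x)\<close>, rows
    \<open>n\<close> and \<open>n + 1\<close> give \<open>s - 1\<close> and \<open>s + 1\<close>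
    with \<open>s = t - a \<bullet> x\<close>, the next \<open>n\<close> rows give the coordinates
    of \<open>f x + a - g\<close>, and the last row gives 0.\<close>
  define C :: "'e conic_constraint" where "C = \<lparr>row_dim = (n + 2) + (n + 1),
      cone_of = prod_cone (n + 2) (Lorentz_cone (n + 2)) (n + 1) (Lorentz_cone (n + 1)),
      aux_dim = 0,
      X_rows = (\<lambda>i. if i < n then - 2 *\<^sub>R b (e i) else if i < n + 2 then a
        else if i < 2 * n + 2 then - adjoint f (e (i - (n + 2))) else 0),
      G_rows = (\<lambda>i. if n + 2 \<le> i \<and> i < 2 * n + 2 then e (i - (n + 2)) else 0),
      T_vec = (\<lambda>i. if i = n \<or> i = n + 1 then - 1 else 0),
      U_mat = (\<lambda>i j. 0),
      rhs_vec = (\<lambda>i. if i = n then - 1 else if i = n + 1 then 1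
        else if n + 2 \<le> i \<and> i < 2 * n + 2 then a \<bullet> e (i - (n + 2)) else 0)\<rparr>"
  have "is_conic_constraint \<K> C"
  proof -
    have "prod_cone m K l L \<in> \<K> (m + l)" if "K \<in> \<K> m" "L \<in> \<K> l" for m K l L
      using assms(1) that unfolding cone_family_def by blast
    from this[of _ "n + 2" _ "n + 1"] show ?thesis
      unfolding is_conic_constraint_def C_def conic_constraint.simps
      by (simp only: assms(2) le_add2 trans_le_add2)
  qed
  moreover have "aux_dim C = 0"
    by (simp add: C_def)
  moreover have "(t, g, x, u) \<in> conic_solutions C \<longleftrightarrow>
      u = (\<lambda>_. 0) \<and> t \<ge> (\<Sum>e\<in>Basis. (b e \<bullet> x)\<^sup>2) + a \<bullet> x \<and> g = f x + a" for t g x u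
  proof -
    define z where "z = (\<lambda>i. conic_rhs C i - conic_lhs C t g x u i)"
    define z1 where "z1 = (\<lambda>i. if i < n + 2 then z i else 0)"
    define z2 where "z2 = (\<lambda>i. z (n + 2 + i))"
    have z: "z \<in> Rvec ((n + 2) + (n + 1))" and z1: "z1 \<in> Rvec (n + 2)" and z2: "z2 \<in> Rvec (n + 1)"
      by (auto simp: z_def z1_def z2_def topspace_Euclidean_space conic_rhs_def conic_lhs_def C_def)
    have "z1 \<in> Lorentz_cone (n + 2) \<longleftrightarrow> (\<Sum>i<n. (b (e i) \<bullet> x)\<^sup>2) \<le> t - a \<bullet> x"
      by (rule Lorentz_cone_quadratic_iff[OF z1])
        (simp_all add: z1_def z_def conic_rhs_def conic_lhs_def C_def)
    moreover have "(\<Sum>i<n. (b (e i) \<bullet> x)\<^sup>2) = (\<Sum>e\<in>Basis. (b e \<bullet> x)\<^sup>2)"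
      by (rule sum.reindex_bij_betw[OF bij])
    moreover have "z2 \<in> Lorentz_cone (n + 1) \<longleftrightarrow> g = f x + a"
    proof -
      have "z2 n = 0"
        by (simp add: z2_def z_def conic_rhs_def conic_lhs_def C_def)
      then have "z2 \<in> Lorentz_cone (n + 1) \<longleftrightarrow> (\<forall>i<n. z2 i = 0)"
        by (rule Lorentz_cone_zero_iff[OF z2])
      also have "\<dots> \<longleftrightarrow> (\<forall>i<n. g \<bullet> e i = (f x + a) \<bullet> e i)"
        by (auto simp: z2_def z_def conic_rhs_def conic_lhs_def C_def inner_add inner_commute
            adjoint_works[OF \<open>linear f\<close>])
      also have "\<dots> \<longleftrightarrow> (\<forall>d\<in>Basis. g \<bullet> d = (f x + a) \<bullet> d)"
        using bij_betw_imp_surj_on[OF bij] by (metis imageE imageI lessThan_iff)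
      finally show ?thesis
        by (simp add: euclidean_eq_iff[of g])
    qed
    moreover have "(t, g, x, u) \<in> conic_solutions C \<longleftrightarrow>
        u \<in> Rvec 0 \<and> z1 \<in> Lorentz_cone (n + 2) \<and> z2 \<in> Lorentz_cone (n + 1)"
    proof -
      have "cone_le (cone_of C) (conic_lhs C t g x u) (conic_rhs C) \<longleftrightarrow>
          z \<in> prod_cone (n + 2) (Lorentz_cone (n + 2)) (n + 1) (Lorentz_cone (n + 1))"
        unfolding cone_le_def z_def[symmetric] by (simp add: C_def)
      also have "\<dots> \<longleftrightarrow> z1 \<in> Lorentz_cone (n + 2) \<and> z2 \<in> Lorentz_cone (n + 1)"
        unfolding prod_cone_def z1_def z2_def using z by simp
      finally show ?thesis
        by (simp add: conic_solutions_def \<open>aux_dim C = 0\<close>)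
    qed
    moreover have "u \<in> Rvec 0 \<longleftrightarrow> u = (\<lambda>_. 0)"
      by (auto simp: topspace_Euclidean_space)
    ultimately show ?thesis
      by auto
  qed
  ultimately show ?thesis
    by (rule that)
qed

text \<open>The solution set is the part of the graph of \<open>F\<close> with \<open>t\<close> at
  least \<open>F x \<bullet> x\<close>: it is upward closed in \<open>t\<close> and equality gives
  the required points.\<close>

lemma conic_representation_of_solutions:
  fixes F :: "'e::euclidean_space \<Rightarrow> 'e"
  assumes "is_conic_constraint \<K> C" and "monotone_field UNIV F"
    and "\<And>t g x u. (t, g, x, u) \<in> conic_solutions C \<longleftrightarrow> u = (\<lambda>_. 0) \<and> t \<ge> F x \<bullet> x \<and> g = F x"
  shows "conic_representation \<K> C F UNIV"
proof -
  have proj: "conic_projection C = {(t, g, x). t \<ge> F x \<bullet> x \<and> g = F x}"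
    using assms(3) by (simp add: conic_projection_def)
  have "F y \<bullet> (x - y) \<le> t - F x \<bullet> y" if "F x \<bullet> x \<le> t" for t x y
  proof -
    have "0 \<le> (F x - F y) \<bullet> (x - y)"
      using assms(2) by (simp add: monotone_field_def)
    with that show ?thesis
      by (simp add: inner_diff)
  qed
  then show ?thesis
    using assms(1) by (auto simp: conic_representation_def proj field_set_def)
qed

theorem mainTheorem11:
  fixes \<K> :: "nat \<Rightarrow> (nat \<Rightarrow> real) set set"
    and A Abar :: "real ^ 'n ^ 'n"
    and a :: "real ^ 'n"
    and F :: "real ^ 'n \<Rightarrow> real ^ 'n"
  assumes "cone_family \<K>"
    and "\<And>k. k \<ge> 1 \<Longrightarrow> Lorentz_cone k \<in> \<K> k"
    and "\<And>x. F x = A *v x + a"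
    and "monotone_field UNIV F"
    and "Abar = (1 / 2) *\<^sub>R (A + transpose A)"
  shows "\<exists>C :: (real ^ 'n) conic_constraint.
           is_conic_constraint \<K> C \<and>
           aux_dim C = 0 \<and>
           (\<forall>t g x. (t, g, x, \<lambda>_. 0) \<in> conic_solutions C \<longleftrightarrow>
              t \<ge> x \<bullet> (Abar *v x) + a \<bullet> x \<and> g = A *v x + a) \<and>
           conic_representation \<K> C F UNIV"
proof -
  have transpose: "x \<bullet> (transpose A *v y) = (A *v x) \<bullet> y" for x y
    by (metis dot_lmul_matrix inner_commute transpose_matrix_vector)
  have Abar: "Abar *v x = (1 / 2) *\<^sub>R (A *v x + transpose A *v x)" for x
    by (simp add: assms(5) scaleR_matrix_vector_assoc[symmetric] matrix_vector_mult_add_rdistrib)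
  have sym: "x \<bullet> (Abar *v y) = (Abar *v x) \<bullet> y" for x y
    using transpose[of x y] transpose[of y x]
    by (simp add: Abar inner_add inner_commute)
  \<comment> \<open>The skew part of \<open>A\<close> contributes nothing to the quadratic form, so
    the bound on \<open>t\<close> is \<open>F x \<bullet> x\<close>.\<close>
  have form: "x \<bullet> (Abar *v x) = (A *v x) \<bullet> x" for x
    using transpose[of x x] by (simp add: Abar inner_add inner_commute)
  have psd: "0 \<le> x \<bullet> (Abar *v x)" for x
  proof -
    \<comment> \<open>Comparison with the origin removes the constant:
      \<open>F x - F 0 = A *v x\<close>.\<close>
    have "0 \<le> (F x - F 0) \<bullet> (x - 0)"
      using assms(4) unfolding monotone_field_def by blast
    then show ?thesis
      by (simp add: form assms(3))
  qed
  obtain b :: "real ^ 'n \<Rightarrow> real ^ 'n"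
    where b: "\<And>x. x \<bullet> (Abar *v x) = (\<Sum>e\<in>Basis. (b e \<bullet> x)\<^sup>2)"
    using psd_form_sum_of_squares[OF matrix_vector_mul_linear sym psd] by blast
  obtain C :: "(real ^ 'n) conic_constraint" where C: "is_conic_constraint \<K> C" "aux_dim C = 0"
    and sol: "\<And>t g x u. (t, g, x, u) \<in> conic_solutions C \<longleftrightarrow>
      u = (\<lambda>_. 0) \<and> t \<ge> x \<bullet> (Abar *v x) + a \<bullet> x \<and> g = A *v x + a"
    using conic_constraint_sum_of_squares[OF assms(1,2) matrix_vector_mul_linear] unfolding b by blast
  have "conic_representation \<K> C F UNIV"
    by (rule conic_representation_of_solutions[OF C(1) assms(4)])
      (simp add: sol form assms(3) inner_add)
  with C sol show ?thesis
    by blast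
qed

end
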